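(* For every integer $p \ge 0$ and every integer $n \ge 0$, $$\sum_{k=0}^n S(n,k)\,(-1)^k\, k!\, h_k^{(p)} = (-1)^n\, n\, p^{n-1}.$$ In particular, for $p=1$ (where $h_k^{(1)} = H_k$), $$\sum_{k=0}^n S(n,k)\,(-1)^k\, k!\, H_k = (-1)^n n.$$
   Context: $S(n,k)$ denotes the Stirling numbers of the second kind. $H_n = 1 + \tfrac12 + \dots + \tfrac1n$ are the harmonic numbers ($H_0=0$). For an integer $p\ge 0$, the hyperharmonic numbers $h_n^{(p)}$ are defined by the generating function $\frac{-\ln(1-t)}{(1-t)^p} = \sum_{n=0}^\infty h_n^{(p)} t^n$ for $|t|<1$; equivalently, $h_n^{(1)}=H_n$, $h_n^{(p+1)} = h_1^{(p)}+\dots+h_n^{(p)}$, and $h_0^{(p)}=0$, and $h_n^{(p+1)} = \binom{n+p}{n}(H_{n+p}-H_p)$. On the right-hand side, $0^0=1$, and for $n=0$ the expression $n p^{n-1}$ is read as $0$. *)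

theory Defs
  imports "HOL-Analysis.Analysis" "HOL-Combinatorics.Stirling"
begin

text \<open>
  \<open>hyperharmonic p n\<close> is $h_n^{(p)}$. The coefficient sequence described here exists and is
  unique: see \<open>hyperharmonic_sums\<close> and \<open>hyperharmonic_eqI\<close> below.
\<close>

definition hyperharmonic :: "nat \<Rightarrow> nat \<Rightarrow> real" where
  "hyperharmonic p =
     (THE h. \<forall>t::real. \<bar>t\<bar> < 1 \<longrightarrow> (\<lambda>n. h n * t ^ n) sums (- ln (1 - t) / (1 - t) ^ p))"

lemma power_series_zero_imp_coeff_zero:
  fixes c :: "nat \<Rightarrow> real"
  assumes "\<And>t. t \<noteq> 0 \<Longrightarrow> \<bar>t\<bar> < 1 \<Longrightarrow> (\<lambda>n. c n * t ^ n) sums 0"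
  shows "c n = 0"
  using assms
proof (induction n arbitrary: c)
  case 0
  have "((\<lambda>t::real. 0) \<longlongrightarrow> c 0) (at 0)"
    by (rule powser_limit_0_strong[of 1]) (use 0 in auto)
  then show ?case by (simp add: tendsto_const_iff)
next
  case (Suc n)
  have "((\<lambda>t::real. 0) \<longlongrightarrow> c 0) (at 0)"
    by (rule powser_limit_0_strong[of 1]) (use Suc.prems in auto)
  then have c0: "c 0 = 0" by (simp add: tendsto_const_iff)
  show ?case
  proof (rule Suc.IH[of "\<lambda>n. c (Suc n)"])
    fix t :: real
    assume t: "t \<noteq> 0" "\<bar>t\<bar> < 1"
    have "(\<lambda>n. c (Suc n) * t ^ Suc n) sums 0"
      using Suc.prems[OF t] c0 by (subst sums_Suc_iff) simp
    from sums_mult[OF this, of "1 / t"] show "(\<lambda>n. c (Suc n) * t ^ n) sums 0"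
      using t by simp
  qed
qed

lemma power_series_coeffs_unique:
  fixes g h :: "nat \<Rightarrow> real"
  assumes "\<And>t. \<bar>t\<bar> < 1 \<Longrightarrow> (\<lambda>n. g n * t ^ n) sums f t"
    and "\<And>t. \<bar>t\<bar> < 1 \<Longrightarrow> (\<lambda>n. h n * t ^ n) sums f t"
  shows "g = h"
proof
  fix n
  have "g n - h n = 0"
  proof (rule power_series_zero_imp_coeff_zero[of "\<lambda>n. g n - h n"])
    fix t :: real
    assume "\<bar>t\<bar> < 1"
    from sums_diff[OF assms(1)[OF this] assms(2)[OF this]]
    show "(\<lambda>n. (g n - h n) * t ^ n) sums 0" by (simp add: left_diff_distrib)
  qed
  then show "g n = h n" by simp
qed

lemma power_series_partial_sums:
  fixes g :: "nat \<Rightarrow> real"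
  assumes g: "\<And>t. \<bar>t\<bar> < 1 \<Longrightarrow> (\<lambda>n. g n * t ^ n) sums f t" and t: "\<bar>t\<bar> < 1"
  shows "(\<lambda>n. (\<Sum>k\<le>n. g k) * t ^ n) sums (f t / (1 - t))"
proof -
  obtain r where r: "\<bar>t\<bar> < r" "r < 1" using dense[OF t] by auto
  have "summable (\<lambda>n. g n * r ^ n)"
    using g[of r] r by (simp add: sums_iff)
  then have a: "summable (\<lambda>n. norm (g n * t ^ n))"
    by (rule powser_insidea) (use r in auto)
  have b: "summable (\<lambda>n. norm (t ^ n))"
    using t by (simp add: power_abs summable_geometric)
  have "(\<lambda>n. \<Sum>k\<le>n. (g k * t ^ k) * t ^ (n - k)) sums ((\<Sum>n. g n * t ^ n) * (\<Sum>n. t ^ n))"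
    by (rule Cauchy_product_sums[OF a b])
  also have "(\<lambda>n. \<Sum>k\<le>n. (g k * t ^ k) * t ^ (n - k)) = (\<lambda>n. (\<Sum>k\<le>n. g k) * t ^ n)"
  proof
    fix n
    show "(\<Sum>k\<le>n. (g k * t ^ k) * t ^ (n - k)) = (\<Sum>k\<le>n. g k) * t ^ n"
      unfolding sum_distrib_right
      by (rule sum.cong) (auto simp: mult.assoc simp flip: power_add)
  qed
  also have "(\<Sum>n. g n * t ^ n) * (\<Sum>n. t ^ n) = f t / (1 - t)"
    using g[OF t] t by (simp add: sums_iff suminf_geometric)
  finally show ?thesis .
qed

lemma hyperharmonic_eqI:
  assumes "\<And>t. \<bar>t\<bar> < 1 \<Longrightarrow> (\<lambda>n. h n * t ^ n) sums (- ln (1 - t) / (1 - t) ^ p)"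
  shows "hyperharmonic p = h"
  unfolding hyperharmonic_def
proof (rule the_equality)
  show "\<forall>t. \<bar>t\<bar> < 1 \<longrightarrow> (\<lambda>n. h n * t ^ n) sums (- ln (1 - t) / (1 - t) ^ p)"
    using assms by blast
next
  fix g :: "nat \<Rightarrow> real"
  assume "\<forall>t. \<bar>t\<bar> < 1 \<longrightarrow> (\<lambda>n. g n * t ^ n) sums (- ln (1 - t) / (1 - t) ^ p)"
  then show "g = h"
    using assms by (intro power_series_coeffs_unique) auto
qed

lemma minus_ln_one_minus_sums:
  fixes t :: real
  assumes "\<bar>t\<bar> < 1"
  shows "(\<lambda>n. 1 / real n * t ^ n) sums (- ln (1 - t) / (1 - t) ^ 0)"
  using sums_minus[OF ln_series'[of "- t"]] assms by simp

lemma hyperharmonic_sums_ex: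
  "\<exists>h. \<forall>t::real. \<bar>t\<bar> < 1 \<longrightarrow> (\<lambda>n. h n * t ^ n) sums (- ln (1 - t) / (1 - t) ^ p)"
proof (induction p)
  case 0
  show ?case by (intro exI allI impI) (rule minus_ln_one_minus_sums)
next
  case (Suc p)
  then obtain h :: "nat \<Rightarrow> real" where
    "\<And>t. \<bar>t\<bar> < 1 \<Longrightarrow> (\<lambda>n. h n * t ^ n) sums (- ln (1 - t) / (1 - t) ^ p)" by blast
  from power_series_partial_sums[OF this] show ?case
    by (intro exI[of _ "\<lambda>n. \<Sum>k\<le>n. h k"] allI impI) (simp add: mult.commute)
qed

lemma hyperharmonic_sums:
  assumes "\<bar>t\<bar> < 1"
  shows "(\<lambda>n. hyperharmonic p n * t ^ n) sums (- ln (1 - t) / (1 - t) ^ p)"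
proof -
  obtain h :: "nat \<Rightarrow> real" where
    h: "\<And>t. \<bar>t\<bar> < 1 \<Longrightarrow> (\<lambda>n. h n * t ^ n) sums (- ln (1 - t) / (1 - t) ^ p)"
    using hyperharmonic_sums_ex by blast
  from hyperharmonic_eqI[OF this] h[OF assms] show ?thesis by simp
qed

lemma hyperharmonic_0: "hyperharmonic 0 n = 1 / real n"
  using hyperharmonic_eqI[OF minus_ln_one_minus_sums] by simp

lemma hyperharmonic_Suc: "hyperharmonic (Suc p) n = (\<Sum>k\<le>n. hyperharmonic p k)"
proof -
  have "hyperharmonic (Suc p) = (\<lambda>n. \<Sum>k\<le>n. hyperharmonic p k)"
    using power_series_partial_sums[OF hyperharmonic_sums]
    by (intro hyperharmonic_eqI) (simp add: mult.commute)
  then show ?thesis by simp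
qed

lemma hyperharmonic_1: "hyperharmonic 1 n = harm n"
proof -
  have "hyperharmonic 1 n = (\<Sum>k\<le>n. 1 / real k)"
    using hyperharmonic_Suc[of 0 n] by (simp add: hyperharmonic_0)
  also have "\<dots> = harm n"
    by (induction n) (simp_all add: harm_Suc harm_expand(1) inverse_eq_divide)
  finally show ?thesis .
qed

end

theory Submission
  imports Defs
begin

text \<open>
  By the recurrence of the Stirling numbers, passing from \<open>n\<close> to \<open>n + 1\<close> in
  $\sum_k S(n,k) (-1)^k k!\, a_k$ amounts to replacing $a_k$ by $k a_k - (k+1) a_{k+1}$; on
  generating functions this is the operator $-(1-t)\,\frac{d}{dt}$. It maps $(1-t)^{-p}$ to
  $-p$ times itself and $-\ln(1-t)\,(1-t)^{-p}$ to $-p$ times itself minus $(1-t)^{-p}$. Hence the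
  sums $T_n$ for $a_k = h_k^{(p)}$ satisfy $T_{n+1} = -p\,T_n - (-p)^n$ with $T_0 = 0$.
\<close>

lemma sum_Stirling_Suc:
  fixes f :: "nat \<Rightarrow> 'a::comm_semiring_1"
  shows "(\<Sum>k\<le>Suc n. of_nat (Stirling (Suc n) k) * f k)
           = (\<Sum>k\<le>n. of_nat (Stirling n k) * (of_nat k * f k + f (Suc k)))"
proof -
  \<comment> \<open>No boundary terms survive: the factor \<open>k\<close> kills index 0, and
    \<open>Stirling n (Suc n)\<close> is 0.\<close>
  have shift: "(\<Sum>k\<le>n. of_nat (Suc k * Stirling n (Suc k)) * f (Suc k))
                 = (\<Sum>k\<le>n. of_nat (k * Stirling n k) * f k)"
    using sum.atMost_Suc_shift[of "\<lambda>k. of_nat (k * Stirling n k) * f k" n] by simp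
  have "(\<Sum>k\<le>Suc n. of_nat (Stirling (Suc n) k) * f k)
          = (\<Sum>k\<le>n. of_nat (Suc k * Stirling n (Suc k)) * f (Suc k))
            + (\<Sum>k\<le>n. of_nat (Stirling n k) * f (Suc k))"
    by (subst sum.atMost_Suc_shift) (simp add: distrib_right sum.distrib del: of_nat_Suc of_nat_mult)
  also have "\<dots> = (\<Sum>k\<le>n. of_nat (Stirling n k) * (of_nat k * f k + f (Suc k)))"
    unfolding shift by (simp add: algebra_simps flip: sum.distrib)
  finally show ?thesis .
qed

text \<open>\<open>fact k * (a gchoose k)\<close> is the falling factorial of \<open>a\<close>, so
  this is the classical expansion of a power. It is used at \<open>a = - real p\<close>, for the
  coefficients of (1-t)^(-p).\<close>

lemma sum_Stirling_gbinomial: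
  fixes a :: "'a::field_char_0"
  shows "(\<Sum>k\<le>n. of_nat (Stirling n k) * (fact k * (a gchoose k))) = a ^ n"
proof (induction n)
  case 0
  show ?case by simp
next
  case (Suc n)
  have step: "of_nat k * (fact k * (a gchoose k)) + fact (Suc k) * (a gchoose Suc k)
                = a * (fact k * (a gchoose k))" for k
  proof -
    have "of_nat k * (fact k * (a gchoose k)) + fact (Suc k) * (a gchoose Suc k)
            = fact k * (of_nat k * (a gchoose k) + of_nat (Suc k) * (a gchoose Suc k))"
      by (simp add: algebra_simps)
    also have "\<dots> = fact k * (a * (a gchoose k))"
      by (simp only: gbinomial_mult_1)
    finally show ?thesis by (simp add: mult_ac)
  qed
  show ?case
    unfolding sum_Stirling_Suc step power_Suc Suc.IH[symmetric]
    by (simp add: sum_distrib_left mult_ac)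
qed

lemma hyperharmonic_at_0: "hyperharmonic p 0 = 0"
  by (induction p) (simp_all add: hyperharmonic_0 hyperharmonic_Suc)

text \<open>
  This is the coefficient form of $(1-t) A' = p A + (1-t)^{-p}$ for
  $A = -\ln(1-t)\,(1-t)^{-p}$.
\<close>

lemma hyperharmonic_recurrence:
  "real (Suc k) * hyperharmonic p (Suc k)
     = (real k + real p) * hyperharmonic p k + (-1) ^ k * (- real p gchoose k)"
proof (induction p arbitrary: k)
  case 0
  \<comment> \<open>The index 0 is separate: there \<open>1 / real k\<close> is 0, while the
    binomial term is 1 instead of 0.\<close>
  show ?case by (cases k) (simp_all add: hyperharmonic_0)
next
  case (Suc p)
  note IH_p = Suc.IH
  \<comment> \<open>Coefficient form of (1-t) * (1-t)^(-p-1) = (1-t)^(-p).\<close>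
  have Pascal: "(-1) ^ Suc k * (- real (Suc p) gchoose Suc k)
      = (-1) ^ k * (- real (Suc p) gchoose k) + (-1) ^ Suc k * (- real p gchoose Suc k)" for k
    using gbinomial_Suc_Suc[of "- real (Suc p)" k] by (simp add: algebra_simps)
  \<comment> \<open>The recurrence at level \<open>p\<close>, summed over the indices up to
    \<open>k\<close>: the left side telescopes and \<open>Pascal\<close> sums the binomials.\<close>
  have "real (Suc k) * hyperharmonic p (Suc k)
          = real p * hyperharmonic (Suc p) k + (-1) ^ k * (- real (Suc p) gchoose k)"
  proof (induction k)
    case 0
    show ?case using IH_p[of 0] by (simp add: hyperharmonic_at_0)
  next
    case (Suc k)
    have "real (Suc (Suc k)) * hyperharmonic p (Suc (Suc k))
            = real (Suc k) * hyperharmonic p (Suc k) + real p * hyperharmonic p (Suc k)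
              + (-1) ^ Suc k * (- real p gchoose Suc k)"
      unfolding IH_p[of "Suc k"]
      by (simp only: distrib_right)
    also have "\<dots> = real p * (hyperharmonic (Suc p) k + hyperharmonic p (Suc k))
              + (-1) ^ Suc k * (- real (Suc p) gchoose Suc k)"
      unfolding Suc.IH Pascal by (simp only: distrib_left add_ac)
    also have "hyperharmonic (Suc p) k + hyperharmonic p (Suc k) = hyperharmonic (Suc p) (Suc k)"
      by (simp add: hyperharmonic_Suc)
    finally show ?case .
  qed
  \<comment> \<open>Adding \<open>real (Suc k) * hyperharmonic (Suc p) k\<close> to both sides
    raises the left side to level \<open>Suc p\<close>.\<close>
  then show ?case
    by (simp add: hyperharmonic_Suc algebra_simps)
qed

lemma sum_Stirling_hyperharmonic:
  "(\<Sum>k\<le>n. real (Stirling n k) * ((-1) ^ k * fact k * hyperharmonic p k))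
     = (-1) ^ n * real n * real p ^ (n - 1)"
proof (induction n)
  case 0
  show ?case by (simp add: hyperharmonic_at_0)
next
  case (Suc n)
  have step: "real k * ((-1) ^ k * fact k * hyperharmonic p k)
                + (-1) ^ Suc k * fact (Suc k) * hyperharmonic p (Suc k)
              = - real p * ((-1) ^ k * fact k * hyperharmonic p k)
                - fact k * (- real p gchoose k)" for k
  proof -
    have "real k * ((-1) ^ k * fact k * hyperharmonic p k)
            + (-1) ^ Suc k * fact (Suc k) * hyperharmonic p (Suc k)
          = (-1) ^ k * fact k
              * (real k * hyperharmonic p k - real (Suc k) * hyperharmonic p (Suc k))"
      by (simp add: algebra_simps)
    also have "\<dots> = - real p * ((-1) ^ k * fact k * hyperharmonic p k)
                 - ((-1) ^ k * (-1) ^ k) * (fact k * (- real p gchoose k))"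
      unfolding hyperharmonic_recurrence by algebra
    \<comment> \<open>The sign of the weight cancels that of the recurrence, leaving a bare falling
      factorial.\<close>
    also have "(-1) ^ k * (-1) ^ k = (1 :: real)"
      by (simp flip: power_mult_distrib)
    finally show ?thesis by simp
  qed
  have "(\<Sum>k\<le>Suc n. real (Stirling (Suc n) k) * ((-1) ^ k * fact k * hyperharmonic p k))
      = - real p * (\<Sum>k\<le>n. real (Stirling n k) * ((-1) ^ k * fact k * hyperharmonic p k))
        - (\<Sum>k\<le>n. real (Stirling n k) * (fact k * (- real p gchoose k)))"
    unfolding sum_Stirling_Suc step
    by (simp add: right_diff_distrib sum_subtractf sum_distrib_left sum_negf mult_ac)
  also have "\<dots> = - real p * ((-1) ^ n * real n * real p ^ (n - 1)) - (- real p) ^ n"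
    unfolding Suc.IH sum_Stirling_gbinomial ..
  also have "\<dots> = (-1) ^ Suc n * real (Suc n) * real p ^ (Suc n - 1)"
    \<comment> \<open>For \<open>n = 0\<close> the exponent \<open>n - 1\<close> truncates to 0, but
      the factor \<open>real n\<close> removes that term; otherwise
      \<open>p * p ^ (n - 1) = p ^ n\<close>.\<close>
    by (cases n) (simp_all add: power_minus[of "real p"] algebra_simps)
  finally show ?case .
qed

theorem theorem1:
  fixes p n :: nat
  shows "(\<Sum>k=0..n. real (Stirling n k) * (-1) ^ k * fact k * hyperharmonic p k)
           = (-1) ^ n * real n * real p ^ (n - 1)
       \<and> (\<Sum>k=0..n. real (Stirling n k) * (-1) ^ k * fact k * harm k) = (-1) ^ n * real n"
  using sum_Stirling_hyperharmonic[of n p] sum_Stirling_hyperharmonic[of n 1]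
  by (simp add: hyperharmonic_1[unfolded One_nat_def] atLeast0AtMost mult.assoc)

end
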